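(* Let $n\ge1$ and let $\tau$ be any one of the three transpositions of $\{i,j,k\}$ (equivalently, fix any one of the three main axes). Let $Y_n(\tau)$ be the set of local triangles $T\in L_n$ whose product point $C_T$ lies on the main axis fixed by $\tau$. Then $$|Y_n(\tau)|=\frac{5^n-2^n}{3}.$$
   Context: $\Delta_n=\{i,j,k,e\}^n$ is the set of words $b=b_1b_2\cdots b_n$ of length $n$ in the four symbols $i,j,k,e$. Put $v(i)=(\cos 210^\circ,\sin 210^\circ)$, $v(j)=(\cos 90^\circ,\sin 90^\circ)$, $v(k)=(\cos 330^\circ,\sin 330^\circ)$, $v(e)=(0,0)$ in $\mathbb R^2$. Fix a real $d_1>0$ and put $d_r=d_1/2^{r-1}$. The centroid map $P:\Delta_n\to\mathbb R^2$ is $$P(b)=\sum_{r=1}^n \sigma_r(b)\,d_r\,v(b_r),\qquad \sigma_r(b)=(-1)^{\#\{s<r:\ b_s=e\}}.$$ $E_n$ is the set of unordered triples $\{b_1,b_2,b_3\}$ of distinct words in $\Delta_n$ such that $P(b_1),P(b_2),P(b_3)$ are the vertices of a nondegenerate equilateral triangle. For $b\in\Delta_n$ put $\mathrm{supp}(b)=\{r: b_r\ne e\}$. Let $\gamma$ be the permutation $i\mapsto j\mapsto k\mapsto i$, $e\mapsto e$. For nonempty $S\subseteq\mathrm{supp}(b)$, $\gamma_S(b)$ is obtained by applying $\gamma$ in the coordinates of $S$ and fixing the others, and $T(b,S)=\{b,\gamma_S(b),\gamma_S^2(b)\}$, which is always an element of $E_n$. The local class is $L_n=\{T(b,S): b\in\Delta_n,\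 \varnothing\ne S\subseteq\mathrm{supp}(b)\}\subseteq E_n$. Words are multiplied coordinatewise as quaternions ($e$ the identity, $i^2=j^2=k^2=-e$, $ij=k$, $jk=i$, $ki=j$, distinct elements of $\{i,j,k\}$ anticommute), with local signs collected into one global sign, giving an element of $\{\pm b:b\in\Delta_n\}$; let $u(\pm b)=b$ for $b\in\Delta_n$. Any two words commute or anticommute, so for $T=\{b_1,b_2,b_3\}\in E_n$ the word $p(T)=u(b_1b_2b_3)$ is well defined. The product point is $C_T=P(p(T))$. A transposition $\tau$ of $\{i,j,k\}$ (with $\tau(e)=e$) acts on words digitwise; via $P$ it corresponds to the reflection of the plane in the line through the origin spanned by $v(f_\tau)$, where $f_\tau\in\{i,j,k\}$ is the unique noncentral digit fixed by $\tau$. This line is the main axis fixed by $\tau$. *)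

theory Defs
  imports "HOL-Analysis.Analysis" "HOL-Combinatorics.Transposition"
begin

datatype digit = Qi | Qj | Qk | Qe

text \<open>Positions of a word are counted from 0, so the position \<open>r\<close> of the mathematical text is
  \<open>b ! (r - 1)\<close>.\<close>

type_synonym word = "digit list"

definition words :: "nat \<Rightarrow> word set" where
  "words n = {b. length b = n}"

definition dir :: "real \<Rightarrow> real ^ 2" where
  "dir \<theta> = vector [cos (\<theta> * pi / 180), sin (\<theta> * pi / 180)]"  \<comment> \<open>angle in degrees\<close>

fun vdig :: "digit \<Rightarrow> real ^ 2" where
  "vdig Qi = dir 210"
| "vdig Qj = dir 90"
| "vdig Qk = dir 330"
| "vdig Qe = 0"

definition sgn_at :: "word \<Rightarrow> nat \<Rightarrow> real" where
  "sgn_at b r = (-1) ^ card {s. s < r \<and> b ! s = Qe}"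

text \<open>With positions counted from 0, the weight $d_{r+1} = d_1/2^r$ belongs to position \<open>r\<close>.\<close>

definition centroid :: "real \<Rightarrow> word \<Rightarrow> real ^ 2" where
  "centroid d\<^sub>1 b = (\<Sum>r<length b. (sgn_at b r * (d\<^sub>1 / 2 ^ r)) *\<^sub>R vdig (b ! r))"

definition equilateral :: "'a::metric_space \<Rightarrow> 'a \<Rightarrow> 'a \<Rightarrow> bool" where
  "equilateral x y z \<longleftrightarrow> dist x y = dist y z \<and> dist y z = dist z x \<and> dist x y > 0"

definition triangles :: "nat \<Rightarrow> real \<Rightarrow> word set set" where
  "triangles n d\<^sub>1 = {{b\<^sub>1, b\<^sub>2, b\<^sub>3} | b\<^sub>1 b\<^sub>2 b\<^sub>3.
     b\<^sub>1 \<in> words n \<and> b\<^sub>2 \<in> words n \<and> b\<^sub>3 \<in> words n \<and> distinct [b\<^sub>1, b\<^sub>2, b\<^sub>3] \<and>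
     equilateral (centroid d\<^sub>1 b\<^sub>1) (centroid d\<^sub>1 b\<^sub>2) (centroid d\<^sub>1 b\<^sub>3)}"

definition supp :: "word \<Rightarrow> nat set" where
  "supp b = {r. r < length b \<and> b ! r \<noteq> Qe}"

fun gam :: "digit \<Rightarrow> digit" where
  "gam Qi = Qj"
| "gam Qj = Qk"
| "gam Qk = Qi"
| "gam Qe = Qe"

definition gam_on :: "nat set \<Rightarrow> word \<Rightarrow> word" where
  "gam_on S b = map (\<lambda>r. if r \<in> S then gam (b ! r) else b ! r) [0..<length b]"

definition loc_tri :: "word \<Rightarrow> nat set \<Rightarrow> word set" where
  "loc_tri b S = {b, gam_on S b, gam_on S (gam_on S b)}"

definition local_class :: "nat \<Rightarrow> word set set" where
  "local_class n = {loc_tri b S | b S. b \<in> words n \<and> S \<noteq> {} \<and> S \<subseteq> supp b}"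

text \<open>Quaternion multiplication of digits: a pair \<open>(s, x)\<close> stands for \<open>s\<cdot>x\<close> with \<open>s = \<plusminus>1\<close>.\<close>

fun dmult :: "digit \<Rightarrow> digit \<Rightarrow> int \<times> digit" where
  "dmult Qe y = (1, y)"
| "dmult x Qe = (1, x)"
| "dmult Qi Qi = (-1, Qe)"
| "dmult Qj Qj = (-1, Qe)"
| "dmult Qk Qk = (-1, Qe)"
| "dmult Qi Qj = (1, Qk)"
| "dmult Qj Qk = (1, Qi)"
| "dmult Qk Qi = (1, Qj)"
| "dmult Qj Qi = (-1, Qk)"
| "dmult Qk Qj = (-1, Qi)"
| "dmult Qi Qk = (-1, Qj)"

type_synonym sword = "int \<times> word"

fun smult :: "sword \<Rightarrow> sword \<Rightarrow> sword" where
  "smult (s, a) (t, b) =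
     (s * t * prod_list (map2 (\<lambda>x y. fst (dmult x y)) a b), map2 (\<lambda>x y. snd (dmult x y)) a b)"

definition plus_word :: "word \<Rightarrow> sword" where
  "plus_word b = (1, b)"

definition unsgn :: "sword \<Rightarrow> word" where
  "unsgn w = snd w"

text \<open>Independence of the order of the three factors is \<open>prod_word_eq\<close> below.\<close>

definition prod_word :: "word set \<Rightarrow> word" where
  "prod_word T = (THE w. \<exists>b\<^sub>1 b\<^sub>2 b\<^sub>3. T = {b\<^sub>1, b\<^sub>2, b\<^sub>3} \<and> distinct [b\<^sub>1, b\<^sub>2, b\<^sub>3] \<and>
     w = unsgn (smult (smult (plus_word b\<^sub>1) (plus_word b\<^sub>2)) (plus_word b\<^sub>3)))"

definition prod_point :: "real \<Rightarrow> word set \<Rightarrow> real ^ 2" where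
  "prod_point d\<^sub>1 T = centroid d\<^sub>1 (prod_word T)"

definition digit_transposition :: "(digit \<Rightarrow> digit) \<Rightarrow> bool" where
  "digit_transposition \<tau> \<longleftrightarrow>
     (\<exists>x y. x \<noteq> y \<and> x \<noteq> Qe \<and> y \<noteq> Qe \<and> \<tau> = Transposition.transpose x y)"

definition fixed_digit :: "(digit \<Rightarrow> digit) \<Rightarrow> digit" where
  "fixed_digit \<tau> = (THE f. f \<noteq> Qe \<and> \<tau> f = f)"

definition main_axis :: "(digit \<Rightarrow> digit) \<Rightarrow> (real ^ 2) set" where
  "main_axis \<tau> = span {vdig (fixed_digit \<tau>)}"

definition Y_set :: "nat \<Rightarrow> real \<Rightarrow> (digit \<Rightarrow> digit) \<Rightarrow> word set set" where
  "Y_set n d\<^sub>1 \<tau> = {T \<in> local_class n. prod_point d\<^sub>1 T \<in> main_axis \<tau>}"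

lemma fixed_digit_unique:
  assumes "digit_transposition \<tau>"
  shows "\<exists>!f. f \<noteq> Qe \<and> \<tau> f = f"
proof -
  obtain x y where xy: "x \<noteq> y" "x \<noteq> Qe" "y \<noteq> Qe" "\<tau> = Transposition.transpose x y"
    using assms unfolding digit_transposition_def by blast
  have "\<forall>f. f \<in> {Qi, Qj, Qk, Qe}" by (metis digit.exhaust insertCI)
  with xy show ?thesis
    by (cases x; cases y) (auto simp: Transposition.transpose_def split: if_splits, (metis+)?)
qed

lemma dmult_comm: "snd (dmult x y) = snd (dmult y x)"
  by (cases x; cases y) auto

lemma dmult_assoc: "snd (dmult (snd (dmult x y)) z) = snd (dmult x (snd (dmult y z)))"
  by (cases x; cases y; cases z) auto

abbreviation wmult :: "word \<Rightarrow> word \<Rightarrow> word" where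
  "wmult \<equiv> map2 (\<lambda>x y. snd (dmult x y))"

lemma wmult_comm: "wmult a b = wmult b a"
  by (rule nth_equalityI) (auto intro: dmult_comm)

lemma wmult_assoc: "wmult (wmult a b) c = wmult a (wmult b c)"
  by (rule nth_equalityI) (auto intro: dmult_assoc)

lemma unsgn_smult3: "unsgn (smult (smult (plus_word a) (plus_word b)) (plus_word c)) = wmult (wmult a b) c"
  by (simp add: unsgn_def plus_word_def)

lemma prod_word_eq:
  assumes "distinct [b\<^sub>1, b\<^sub>2, b\<^sub>3]"
  shows "prod_word {b\<^sub>1, b\<^sub>2, b\<^sub>3} = unsgn (smult (smult (plus_word b\<^sub>1) (plus_word b\<^sub>2)) (plus_word b\<^sub>3))"
  unfolding prod_word_def unsgn_smult3
proof (rule the_equality)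
  show "\<exists>c\<^sub>1 c\<^sub>2 c\<^sub>3. {b\<^sub>1, b\<^sub>2, b\<^sub>3} = {c\<^sub>1, c\<^sub>2, c\<^sub>3} \<and> distinct [c\<^sub>1, c\<^sub>2, c\<^sub>3] \<and>
     wmult (wmult b\<^sub>1 b\<^sub>2) b\<^sub>3 = wmult (wmult c\<^sub>1 c\<^sub>2) c\<^sub>3"
    using assms by blast
next
  fix w
  assume "\<exists>c\<^sub>1 c\<^sub>2 c\<^sub>3. {b\<^sub>1, b\<^sub>2, b\<^sub>3} = {c\<^sub>1, c\<^sub>2, c\<^sub>3} \<and> distinct [c\<^sub>1, c\<^sub>2, c\<^sub>3] \<and>
     w = wmult (wmult c\<^sub>1 c\<^sub>2) c\<^sub>3"
  then obtain c\<^sub>1 c\<^sub>2 c\<^sub>3 where c: "{b\<^sub>1, b\<^sub>2, b\<^sub>3} = {c\<^sub>1, c\<^sub>2, c\<^sub>3}" "distinct [c\<^sub>1, c\<^sub>2, c\<^sub>3]"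
    and w: "w = wmult (wmult c\<^sub>1 c\<^sub>2) c\<^sub>3"
    by blast
  consider "c\<^sub>1 = b\<^sub>1" "c\<^sub>2 = b\<^sub>2" "c\<^sub>3 = b\<^sub>3" | "c\<^sub>1 = b\<^sub>1" "c\<^sub>2 = b\<^sub>3" "c\<^sub>3 = b\<^sub>2"
    | "c\<^sub>1 = b\<^sub>2" "c\<^sub>2 = b\<^sub>1" "c\<^sub>3 = b\<^sub>3" | "c\<^sub>1 = b\<^sub>2" "c\<^sub>2 = b\<^sub>3" "c\<^sub>3 = b\<^sub>1"
    | "c\<^sub>1 = b\<^sub>3" "c\<^sub>2 = b\<^sub>1" "c\<^sub>3 = b\<^sub>2" | "c\<^sub>1 = b\<^sub>3" "c\<^sub>2 = b\<^sub>2" "c\<^sub>3 = b\<^sub>1"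
    using c assms by (simp add: set_eq_iff) metis
  then show "w = wmult (wmult b\<^sub>1 b\<^sub>2) b\<^sub>3"
    unfolding w by cases (metis wmult_comm wmult_assoc)+
qed

text \<open>Rotation by $-120$ degrees, the action of \<open>gam\<close> on the vectors \<open>vdig\<close>.\<close>

definition rot :: "real ^ 2 \<Rightarrow> real ^ 2" where
  "rot p = vector [- (p $ 1) / 2 + sqrt 3 / 2 * p $ 2, - sqrt 3 / 2 * p $ 1 - p $ 2 / 2]"

lemma linear_rot: "linear rot"
  by (rule linearI) (auto simp: rot_def vec_eq_iff forall_2 algebra_simps diff_divide_distrib add_divide_distrib)

lemma norm_rot: "norm (rot p) = norm p"
proof -
  have "(- (p $ 1) / 2 + sqrt 3 / 2 * p $ 2)\<^sup>2 + (- sqrt 3 / 2 * p $ 1 - p $ 2 / 2)\<^sup>2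
      = (p $ 1)\<^sup>2 + (p $ 2)\<^sup>2"
    by (simp add: power2_eq_square field_simps)
  then show ?thesis
    by (simp add: norm_vec_def L2_set_def UNIV_2 rot_def)
qed

lemma rot3: "rot (rot (rot p)) = p"
proof -
  have s: "sqrt 3 * (sqrt 3 * x) = 3 * x" for x by (simp flip: mult.assoc)
  show ?thesis
    by (simp add: rot_def vec_eq_iff forall_2 algebra_simps diff_divide_distrib add_divide_distrib s)
qed

lemma rot_fix: assumes "rot p = p" shows "p = 0"
proof -
  have a: "- (p $ 1) / 2 + sqrt 3 / 2 * p $ 2 = p $ 1" "- sqrt 3 / 2 * p $ 1 - p $ 2 / 2 = p $ 2"
    using assms by (auto simp: rot_def vec_eq_iff forall_2)
  have "sqrt 3 * p $ 2 = 3 * p $ 1" "sqrt 3 * p $ 1 = - 3 * p $ 2"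
    using a by (auto simp: field_simps)
  then have "sqrt 3 * (sqrt 3 * p $ 1) = - 9 * p $ 1" by simp
  then have "p $ 1 = 0" by (simp flip: mult.assoc)
  then show ?thesis using \<open>sqrt 3 * p $ 2 = 3 * p $ 1\<close> by (simp add: vec_eq_iff forall_2)
qed

lemma dir_values:
  "dir 210 = vector [- sqrt 3 / 2, - 1 / 2]" "dir 90 = vector [0, 1]"
  "dir 330 = vector [sqrt 3 / 2, - 1 / 2]"
proof -
  have a: "210 * pi / 180 = pi / 6 + pi" "330 * pi / 180 = 2 * pi - pi / 6" by auto
  show "dir 210 = vector [- sqrt 3 / 2, - 1 / 2]"
    unfolding dir_def a by (simp only: cos_periodic_pi sin_periodic_pi cos_30 sin_30 minus_divide_left)
  show "dir 90 = vector [0, 1]"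
    unfolding dir_def by (simp add: cos_pi_half sin_pi_half)
  show "dir 330 = vector [sqrt 3 / 2, - 1 / 2]"
    unfolding dir_def a by (simp only: cos_2pi_minus sin_2pi_minus cos_30 sin_30 minus_divide_left)
qed

lemma vdig_gam: "vdig (gam x) = rot (vdig x)"
  by (cases x) (auto simp: dir_values rot_def vec_eq_iff forall_2)

lemma norm_vdig: "norm (vdig x) = (if x = Qe then 0 else 1)"
  by (cases x) (auto simp: dir_values norm_vec_def L2_set_def UNIV_2 power_divide)

lemma gam_eq_Qe [simp]: "gam x = Qe \<longleftrightarrow> x = Qe"
  by (cases x) auto

lemma length_gam_on [simp]: "length (gam_on S b) = length b"
  by (simp add: gam_on_def)

lemma nth_gam_on: "r < length b \<Longrightarrow> gam_on S b ! r = (if r \<in> S then gam (b ! r) else b ! r)"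
  by (simp add: gam_on_def)

lemma sgn_at_gam_on: "r < length b \<Longrightarrow> sgn_at (gam_on S b) r = sgn_at b r"
  unfolding sgn_at_def
  by (rule arg_cong[where f = "\<lambda>A. (-1) ^ card A"]) (auto simp: nth_gam_on split: if_splits)

lemma supp_gam_on [simp]: "supp (gam_on S b) = supp b"
  by (auto simp: supp_def nth_gam_on split: if_splits)

definition part :: "real \<Rightarrow> nat set \<Rightarrow> word \<Rightarrow> real ^ 2" where
  "part d\<^sub>1 S b = (\<Sum>r\<in>S. (sgn_at b r * (d\<^sub>1 / 2 ^ r)) *\<^sub>R vdig (b ! r))"

lemma part_split:
  assumes "S \<subseteq> supp b"
  shows "centroid d\<^sub>1 b = part d\<^sub>1 ({..<length b} - S) b + part d\<^sub>1 S b"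
  unfolding centroid_def part_def
  using assms by (intro sum.subset_diff) (auto simp: supp_def)

lemma part_in: assumes "S \<subseteq> supp b" shows "part d\<^sub>1 S (gam_on S b) = rot (part d\<^sub>1 S b)"
  unfolding part_def linear_sum[OF linear_rot] linear_cmul[OF linear_rot]
  using assms by (intro sum.cong) (auto simp: supp_def sgn_at_gam_on nth_gam_on vdig_gam subset_iff)

lemma part_out: "part d\<^sub>1 ({..<length b} - S) (gam_on S b) = part d\<^sub>1 ({..<length b} - S) b"
  unfolding part_def
  by (intro sum.cong) (auto simp: sgn_at_gam_on nth_gam_on)

lemma geometric_tail: "m < n \<Longrightarrow> (\<Sum>r\<in>{m<..<n}. 1 / 2 ^ r :: real) = 1 / 2 ^ m - 2 / 2 ^ n"
proof (induction n)
  case (Suc n)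
  show ?case
  proof (cases "m = n")
    case True
    then have "{m<..<Suc n} = {}" by auto
    then show ?thesis using True by simp
  next
    case False
    then have "{m<..<Suc n} = insert n {m<..<n}" "m < n" using Suc.prems by auto
    then show ?thesis using Suc.IH by simp
  qed
qed simp

lemma part_nonzero:
  assumes "d\<^sub>1 > 0" "S \<noteq> {}" "S \<subseteq> supp b"
  shows "part d\<^sub>1 S b \<noteq> 0"
proof
  assume z: "part d\<^sub>1 S b = 0"
  let ?t = "\<lambda>r. (sgn_at b r * (d\<^sub>1 / 2 ^ r)) *\<^sub>R vdig (b ! r)"
  let ?n = "length b"
  have fin: "finite S" using assms(3) by (rule finite_subset) (simp add: supp_def)
  define m where "m = Min S"
  have mS: "m \<in> S" using fin assms(2) by (simp add: m_def)
  have sub: "S - {m} \<subseteq> {m<..<?n}"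
    using fin assms(3) by (auto simp: m_def supp_def less_le)
  have nrm: "norm (?t r) = d\<^sub>1 / 2 ^ r" if "r \<in> S" for r
    using that assms by (auto simp: norm_vdig sgn_at_def supp_def abs_mult)
  have "?t m = - (\<Sum>r\<in>S - {m}. ?t r)"
    using z sum.remove[OF fin mS, of ?t] by (simp add: part_def eq_neg_iff_add_eq_0)
  then have "d\<^sub>1 / 2 ^ m = norm (\<Sum>r\<in>S - {m}. ?t r)"
    using nrm[OF mS] by simp
  also have "\<dots> \<le> (\<Sum>r\<in>S - {m}. d\<^sub>1 / 2 ^ r)"
    using nrm by (intro sum_norm_le) auto
  also have "\<dots> \<le> (\<Sum>r\<in>{m<..<?n}. d\<^sub>1 / 2 ^ r)"
    using sub assms(1) by (intro sum_mono2) auto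
  also have "\<dots> = d\<^sub>1 * (1 / 2 ^ m - 2 / 2 ^ ?n)"
    using mS assms(3) by (subst geometric_tail[symmetric]) (auto simp: supp_def sum_distrib_left)
  also have "\<dots> < d\<^sub>1 * (1 / 2 ^ m)"
    using assms(1) by (intro mult_strict_left_mono) auto
  finally show False by simp
qed

lemma local_class_subset_triangles:
  assumes "d\<^sub>1 > 0"
  shows "local_class n \<subseteq> triangles n d\<^sub>1"
proof
  fix T assume "T \<in> local_class n"
  then obtain b S where b: "b \<in> words n" "S \<noteq> {}" "S \<subseteq> supp b" and T: "T = loc_tri b S"
    unfolding local_class_def by blast
  let ?b1 = "gam_on S b" let ?b2 = "gam_on S (gam_on S b)"
  define A where "A = part d\<^sub>1 ({..<length b} - S) b"
  define B where "B = part d\<^sub>1 S b"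
  have c0: "centroid d\<^sub>1 b = A + B"
    unfolding A_def B_def using b(3) by (rule part_split)
  have c1: "centroid d\<^sub>1 ?b1 = A + rot B"
    using b(3) part_split[of S ?b1 d\<^sub>1] by (simp add: A_def B_def part_in part_out)
  have c2: "centroid d\<^sub>1 ?b2 = A + rot (rot B)"
    using b(3) part_split[of S ?b2 d\<^sub>1] part_out[of d\<^sub>1 ?b1 S] part_out[of d\<^sub>1 b S]
    by (simp add: A_def B_def part_in)
  have B: "rot B \<noteq> B"
    using rot_fix part_nonzero[OF assms b(2,3)] unfolding B_def by blast
  have n: "dist (A + rot p) (A + rot q) = dist (A + p) (A + q)" for p q
    using norm_rot[of "p - q"] by (simp add: dist_norm linear_diff[OF linear_rot])
  have eq: "equilateral (centroid d\<^sub>1 b) (centroid d\<^sub>1 ?b1) (centroid d\<^sub>1 ?b2)"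
    unfolding equilateral_def c0 c1 c2
    using n[of B "rot B"] n[of "rot B" "rot (rot B)"] B by (simp add: rot3)
  then have "distinct [b, ?b1, ?b2]"
    unfolding equilateral_def by (auto simp: dist_commute)
  with eq b(1) show "T \<in> triangles n d\<^sub>1"
    unfolding triangles_def T loc_tri_def words_def
    by (intro CollectI exI[of _ b] exI[of _ ?b1] exI[of _ ?b2]) simp
qed

end

theory Submission
  imports Defs
begin

text \<open>
  Multiplying the three words of \<open>loc_tri b S\<close> position by position, a position in \<open>S\<close> contributes
  the three imaginary units in some order, hence \<open>\<plusminus>e\<close>, and a position outside \<open>S\<close> contributes the
  cube of the common digit, hence that digit up to sign. So the product word is \<open>b\<close> with the
  positions of \<open>S\<close> overwritten by \<open>Qe\<close> (\<open>prod_word_loc_tri\<close>).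

  The centroid of a word \<open>c\<close> lies on the line through \<open>vdig f\<close> only if no digit of \<open>c\<close> other than
  \<open>Qe\<close> and \<open>f\<close> occurs (\<open>centroid_on_axis_iff\<close>). Indeed, the distance to that line is measured by a
  linear functional that vanishes on the vectors of \<open>Qe\<close> and \<open>f\<close> and takes the values
  \<open>\<plusminus>sqrt 3 / 2\<close> on the two others, so it maps the centroid to a multiple of a signed sum of
  distinct powers of two, and a nonempty sum of this kind is dominated by its largest term.

  Together these facts say that the triangle \<open>loc_tri b S\<close> is counted exactly if all positions
  outside \<open>S\<close> carry \<open>Qe\<close> or \<open>f\<close>. A pair \<open>(b, S)\<close> of this kind amounts to a free choice, at each
  position, among five possibilities: one of three noncentral digits in \<open>S\<close>, or one of two digits
  outside \<open>S\<close>. This gives \<open>5 ^ n\<close> pairs, and \<open>2 ^ n\<close> of them have empty \<open>S\<close>. Finally \<open>S\<close> can be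
  read off from a triangle as the set of positions where its words disagree, and \<open>b\<close> can be any
  of the three words, so each triangle arises from exactly three pairs
  (\<open>card_loc_tri_fibre\<close>).
\<close>

section \<open>The words of a local triangle\<close>

lemma gam_gam_gam [simp]: "gam (gam (gam x)) = x"
  by (cases x) auto

lemma gam_neq: "x \<noteq> Qe \<Longrightarrow> gam x \<noteq> x" "x \<noteq> Qe \<Longrightarrow> gam (gam x) \<noteq> x"
  by (cases x; simp)+

lemma gam_on_gam_on_gam_on [simp]: "gam_on S (gam_on S (gam_on S b)) = b"
  by (rule nth_equalityI) (auto simp: nth_gam_on)

lemma distinct_loc_tri:
  assumes "S \<noteq> {}" "S \<subseteq> supp b"
  shows "distinct [b, gam_on S b, gam_on S (gam_on S b)]"
proof -
  obtain r where r: "r \<in> S" "r < length b" "b ! r \<noteq> Qe"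
    using assms by (auto simp: supp_def)
  then have "gam (b ! r) \<noteq> b ! r" "gam (gam (b ! r)) \<noteq> b ! r" "gam (gam (b ! r)) \<noteq> gam (b ! r)"
    by (simp_all add: gam_neq)
  moreover have "gam_on S b ! r = gam (b ! r)" "gam_on S (gam_on S b) ! r = gam (gam (b ! r))"
    using r by (simp_all add: nth_gam_on)
  ultimately show ?thesis
    by (metis distinct_length_2_or_more distinct_singleton)
qed

lemma loc_tri_gam_on [simp]: "loc_tri (gam_on S b) S = loc_tri b S"
  by (auto simp: loc_tri_def)

text \<open>This recovers \<open>S\<close> from the triangle alone.\<close>

lemma disagreement_loc_tri:
  assumes "S \<subseteq> supp b"
  shows "{r. \<exists>x\<in>loc_tri b S. \<exists>y\<in>loc_tri b S. r < length x \<and> x ! r \<noteq> y ! r} = S"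
proof (intro set_eqI iffI)
  fix r assume "r \<in> S"
  then have "r < length b" "gam_on S b ! r \<noteq> b ! r"
    using assms by (auto simp: supp_def nth_gam_on gam_neq)
  then show "r \<in> {r. \<exists>x\<in>loc_tri b S. \<exists>y\<in>loc_tri b S. r < length x \<and> x ! r \<noteq> y ! r}"
    by (auto simp: loc_tri_def)
qed (auto simp: loc_tri_def nth_gam_on split: if_splits)

definition tri_param :: "nat \<Rightarrow> (word \<times> nat set) set" where
  "tri_param n = {(b, S). b \<in> words n \<and> S \<noteq> {} \<and> S \<subseteq> supp b}"

lemma local_class_eq_image: "local_class n = (\<lambda>(b, S). loc_tri b S) ` tri_param n"
  by (auto simp: local_class_def tri_param_def)

lemma loc_tri_fibre:
  assumes "(b, S) \<in> tri_param n"
  shows "{p \<in> tri_param n. (\<lambda>(b, S). loc_tri b S) p = loc_tri b S}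
    = (\<lambda>c. (c, S)) ` loc_tri b S"
proof (intro equalityI subsetI)
  fix p assume p: "p \<in> {p \<in> tri_param n. (\<lambda>(b, S). loc_tri b S) p = loc_tri b S}"
  obtain c R where cR: "p = (c, R)" by (cases p)
  have eq: "loc_tri c R = loc_tri b S" using p cR by simp
  then have "R = S"
    using disagreement_loc_tri[of R c] disagreement_loc_tri[of S b] p assms
    by (simp add: cR tri_param_def)
  moreover have "c \<in> loc_tri b S" using eq by (auto simp: loc_tri_def)
  ultimately show "p \<in> (\<lambda>c. (c, S)) ` loc_tri b S" by (simp add: cR)
qed (use assms in \<open>auto simp: loc_tri_def tri_param_def words_def\<close>)

lemma card_loc_tri_fibre:
  assumes "(b, S) \<in> tri_param n"
  shows "card {p \<in> tri_param n. (\<lambda>(b, S). loc_tri b S) p = loc_tri b S} = 3"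
proof -
  have "card (loc_tri b S) = 3"
    using distinct_loc_tri[of S b] assms by (simp add: loc_tri_def tri_param_def)
  then show ?thesis
    unfolding loc_tri_fibre[OF assms] by (simp add: card_image inj_on_def)
qed

section \<open>The product word of a local triangle\<close>

lemma prod_word_loc_tri:
  assumes "S \<noteq> {}" "S \<subseteq> supp b"
  shows "prod_word (loc_tri b S) = map (\<lambda>r. if r \<in> S then Qe else b ! r) [0..<length b]"
proof -
  have in_S: "snd (dmult (snd (dmult x (gam x))) (gam (gam x))) = Qe" for x
    by (cases x) auto
  have off_S: "snd (dmult (snd (dmult x x)) x) = x" for x
    by (cases x) auto
  show ?thesis
    unfolding loc_tri_def prod_word_eq[OF distinct_loc_tri[OF assms]] unsgn_smult3
    by (rule nth_equalityI) (auto simp: nth_gam_on in_S off_S)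
qed

section \<open>Centroids on an axis\<close>

text \<open>The term of least index exceeds the sum of all the others in absolute value, because the
  binary tail is finite.\<close>

lemma signed_binary_sum_nonzero:
  fixes t :: "nat \<Rightarrow> real"
  assumes "finite S" "S \<noteq> {}" "c > 0" and t: "\<And>r. r \<in> S \<Longrightarrow> \<bar>t r\<bar> = c / 2 ^ r"
  shows "sum t S \<noteq> 0"
proof
  assume z: "sum t S = 0"
  define m where "m = Min S"
  define N where "N = Suc (Max S)"
  have m: "m \<in> S" using assms(1,2) by (simp add: m_def)
  have sub: "S - {m} \<subseteq> {m<..<N}"
    using Min_le[OF assms(1)] Max_ge[OF assms(1)]
    by (fastforce simp: m_def N_def le_less less_Suc_eq_le)
  have "m < N" using m assms(1) by (simp add: N_def less_Suc_eq_le)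
  have "t m = - sum t (S - {m})"
    using z sum.remove[OF assms(1) m, of t] by simp
  then have "c / 2 ^ m = \<bar>sum t (S - {m})\<bar>"
    using t[OF m] by simp
  also have "\<dots> \<le> (\<Sum>r\<in>S - {m}. \<bar>t r\<bar>)"
    by (rule sum_abs)
  also have "\<dots> = (\<Sum>r\<in>S - {m}. c / 2 ^ r)"
    using t by simp
  also have "\<dots> \<le> (\<Sum>r\<in>{m<..<N}. c / 2 ^ r)"
    using sub assms(3) by (intro sum_mono2) auto
  also have "\<dots> = c * (1 / 2 ^ m - 2 / 2 ^ N)"
    by (subst geometric_tail[OF \<open>m < N\<close>, symmetric]) (simp add: sum_distrib_left)
  also have "\<dots> < c * (1 / 2 ^ m)"
    using assms(3) by (intro mult_strict_left_mono) auto
  finally show False by simp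
qed

text \<open>The two-dimensional cross product; with a unit vector as second argument it is the signed
  distance to the line spanned by that vector.\<close>

definition cross2 :: "real ^ 2 \<Rightarrow> real ^ 2 \<Rightarrow> real" where
  "cross2 p q = p $ 1 * q $ 2 - p $ 2 * q $ 1"

lemma cross2_sum_left: "cross2 (\<Sum>r\<in>A. a r *\<^sub>R p r) q = (\<Sum>r\<in>A. a r * cross2 (p r) q)"
  by (simp add: cross2_def sum_distrib_right right_diff_distrib sum_subtractf mult.assoc)

lemma abs_cross2_vdig:
  assumes "f \<noteq> Qe"
  shows "\<bar>cross2 (vdig x) (vdig f)\<bar> = (if x \<in> {Qe, f} then 0 else sqrt 3 / 2)"
  using assms by (cases x; cases f) (auto simp: cross2_def dir_values)

text \<open>No cancellation between the weights can bring a word with a foreign digit onto the axis,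
  so membership of the centroid is decided digit by digit.\<close>

lemma centroid_on_axis_iff:
  assumes "d > 0" "f \<noteq> Qe"
  shows "centroid d b \<in> span {vdig f} \<longleftrightarrow> (\<forall>r<length b. b ! r \<in> {Qe, f})"
proof
  assume on: "\<forall>r<length b. b ! r \<in> {Qe, f}"
  have "vdig (b ! r) \<in> span {vdig f}" if "r < length b" for r
    using on that by (cases "b ! r = Qe") (auto simp: span_0 span_base)
  then show "centroid d b \<in> span {vdig f}"
    unfolding centroid_def by (intro span_sum span_scale) simp
next
  assume "centroid d b \<in> span {vdig f}"
  then obtain k where k: "centroid d b = k *\<^sub>R vdig f"
    by (auto simp: span_singleton)
  let ?t = "\<lambda>r. (sgn_at b r * (d / 2 ^ r)) * cross2 (vdig (b ! r)) (vdig f)"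
  define R where "R = {r. r < length b \<and> b ! r \<notin> {Qe, f}}"
  have "sum ?t {..<length b} = cross2 (centroid d b) (vdig f)"
    by (simp add: centroid_def cross2_sum_left)
  also have "\<dots> = 0" by (simp add: k cross2_def)
  finally have "sum ?t {..<length b} = 0" .
  moreover have "sum ?t R = sum ?t {..<length b}"
    by (intro sum.mono_neutral_left) (auto simp: R_def cross2_def)
  ultimately have "sum ?t R = 0" by simp
  moreover have "\<bar>?t r\<bar> = (d * sqrt 3 / 2) / 2 ^ r" if "r \<in> R" for r
    using that assms by (simp add: R_def abs_mult abs_cross2_vdig sgn_at_def)
  ultimately have "R = {}"
    using signed_binary_sum_nonzero[of R "d * sqrt 3 / 2" ?t] assms(1) by (force simp: R_def)
  then show "\<forall>r<length b. b ! r \<in> {Qe, f}" by (auto simp: R_def)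
qed

section \<open>Counting\<close>

definition axis_param :: "nat \<Rightarrow> digit \<Rightarrow> (word \<times> nat set) set" where
  "axis_param n f =
    {(b, S). b \<in> words n \<and> S \<subseteq> supp b \<and> (\<forall>r<n. r \<notin> S \<longrightarrow> b ! r \<in> {Qe, f})}"

lemma prod_point_on_axis_iff:
  assumes "d > 0" "f \<noteq> Qe" "(b, S) \<in> tri_param n"
  shows "prod_point d (loc_tri b S) \<in> span {vdig f} \<longleftrightarrow> (b, S) \<in> axis_param n f"
  using assms(3)
  by (auto simp: prod_point_def prod_word_loc_tri centroid_on_axis_iff[OF assms(1,2)]
      axis_param_def tri_param_def words_def)

text \<open>Marking each digit with its membership in \<open>S\<close> turns the pairs into the words of length \<open>n\<close>
  over an alphabet of five letters.\<close>

lemma card_axis_param: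
  assumes "f \<noteq> Qe"
  shows "finite (axis_param n f)" "card (axis_param n f) = 5 ^ n"
proof -
  define A where "A = {(Qi, True), (Qj, True), (Qk, True), (Qe, False), (f, False)}"
  define W where "W = {xs. set xs \<subseteq> A \<and> length xs = n}"
  have A: "(x, s) \<in> A \<longleftrightarrow> (if s then x \<noteq> Qe else x \<in> {Qe, f})" for x s
    by (cases x) (auto simp: A_def)
  have cA: "finite A" "card A = 5" using assms by (auto simp: A_def)
  let ?mark = "\<lambda>(b, S). map (\<lambda>r. (b ! r, r \<in> S)) [0..<n]"
  let ?unmark = "\<lambda>xs. (map fst xs, {r. r < n \<and> snd (xs ! r)})"
  have "bij_betw ?mark (axis_param n f) W"
  proof (rule bij_betw_byWitness[where f' = ?unmark])
    show "\<forall>p\<in>axis_param n f. ?unmark (?mark p) = p"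
      by (auto simp: axis_param_def words_def supp_def intro!: nth_equalityI)
    show "\<forall>xs\<in>W. ?mark (?unmark xs) = xs"
      by (auto simp: W_def intro!: nth_equalityI)
    show "?mark ` axis_param n f \<subseteq> W"
      by (fastforce simp: W_def A axis_param_def words_def supp_def)
    have "?unmark xs \<in> axis_param n f" if "xs \<in> W" for xs
    proof -
      have "if snd (xs ! r) then fst (xs ! r) \<noteq> Qe else fst (xs ! r) \<in> {Qe, f}"
        if "r < n" for r
        using \<open>xs \<in> W\<close> that by (auto simp: W_def simp flip: A)
      then have "\<forall>r<n. snd (xs ! r) \<longrightarrow> fst (xs ! r) \<noteq> Qe"
        and "\<forall>r<n. \<not> snd (xs ! r) \<longrightarrow> fst (xs ! r) \<in> {Qe, f}"
        by presburger+
      then show ?thesis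
        using \<open>xs \<in> W\<close> by (simp add: W_def axis_param_def words_def supp_def subset_iff)
    qed
    then show "?unmark ` W \<subseteq> axis_param n f" by blast
  qed
  moreover have "finite W" "card W = 5 ^ n"
    using cA by (simp_all add: W_def finite_lists_length_eq card_lists_length_eq)
  ultimately show "finite (axis_param n f)" "card (axis_param n f) = 5 ^ n"
    by (simp_all add: bij_betw_finite bij_betw_same_card)
qed

lemma card_axis_param_empty:
  assumes "f \<noteq> Qe"
  shows "card {p \<in> axis_param n f. snd p = {}} = 2 ^ n"
proof -
  have "{p \<in> axis_param n f. snd p = {}}
      = (\<lambda>b. (b, {})) ` {b. set b \<subseteq> {Qe, f} \<and> length b = n}"
    by (auto simp: axis_param_def words_def subset_iff in_set_conv_nth image_iff)
  then show ?thesis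
    using assms by (simp add: card_image inj_on_def card_lists_length_eq numeral_2_eq_2)
qed

theorem proposition7p1:
  fixes n :: nat and d\<^sub>1 :: real and \<tau> :: "digit \<Rightarrow> digit"
  assumes "n \<ge> 1"
    and "d\<^sub>1 > 0"
    and "digit_transposition \<tau>"
  shows "real (card (Y_set n d\<^sub>1 \<tau>)) = (5 ^ n - 2 ^ n) / 3"
proof -
  define f where "f = fixed_digit \<tau>"
  have f: "f \<noteq> Qe"
    using theI'[OF fixed_digit_unique[OF assms(3)]] by (simp add: f_def fixed_digit_def)
  define D where "D = tri_param n \<inter> axis_param n f"
  let ?tri = "\<lambda>(b, S). loc_tri b S"
  have on: "prod_point d\<^sub>1 (?tri p) \<in> main_axis \<tau> \<longleftrightarrow> p \<in> axis_param n f"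
    if "p \<in> tri_param n" for p
    using prod_point_on_axis_iff[OF assms(2) f] that
    by (cases p) (simp add: main_axis_def f_def)
  have Y: "Y_set n d\<^sub>1 \<tau> = ?tri ` D"
    unfolding Y_set_def local_class_eq_image D_def using on by blast
  have D_diff: "D = axis_param n f - {p \<in> axis_param n f. snd p = {}}"
    by (auto simp: D_def tri_param_def axis_param_def)
  have fin: "finite D" unfolding D_diff using card_axis_param(1)[OF f] by simp
  have "card D = 5 ^ n - 2 ^ n"
    unfolding D_diff using card_axis_param[OF f] card_axis_param_empty[OF f]
    by (subst card_Diff_subset) auto
  moreover have "card D = (\<Sum>T\<in>?tri ` D. card {p \<in> D. ?tri p = T})"
    using sum.image_gen[OF fin, of "\<lambda>_. 1 :: nat" ?tri] by simp
  moreover have "card {p \<in> D. ?tri p = T} = 3" if T: "T \<in> ?tri ` D" for T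
  proof -
    obtain b S where bS: "(b, S) \<in> D" "T = loc_tri b S" using T by auto
    \<comment> \<open>The axis condition depends on the triangle only, so \<open>D\<close> contains the whole fibre.\<close>
    have "{p \<in> D. ?tri p = T} = {p \<in> tri_param n. ?tri p = loc_tri b S}"
    proof (intro equalityI subsetI)
      fix p assume p: "p \<in> {p \<in> tri_param n. ?tri p = loc_tri b S}"
      then have "?tri p = ?tri (b, S)" by simp
      then have "p \<in> axis_param n f"
        using on[of p] on[of "(b, S)"] p bS by (auto simp only: D_def)
      then show "p \<in> {p \<in> D. ?tri p = T}" using p bS by (simp add: D_def)
    qed (auto simp: D_def bS)
    then show ?thesis using card_loc_tri_fibre[of b S n] bS by (simp add: D_def)
  qed
  ultimately have "5 ^ n - 2 ^ n = 3 * card (Y_set n d\<^sub>1 \<tau>)"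
    by (simp add: Y)
  moreover have "(2::nat) ^ n \<le> 5 ^ n" by (rule power_mono) auto
  ultimately have "(5::nat) ^ n = 2 ^ n + 3 * card (Y_set n d\<^sub>1 \<tau>)" by linarith
  then have "(5::real) ^ n = 2 ^ n + 3 * real (card (Y_set n d\<^sub>1 \<tau>))"
    by (metis of_nat_add of_nat_mult of_nat_numeral of_nat_power)
  then show ?thesis by simp
qed

end
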